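(* Let $\mathcal{G}$ be a (non-empty) finite groupoid and let $S$ be a $\mathcal{G}$-monoid. Then the Burnside ring $B(\mathcal{G})$ of $\mathcal{G}$ can be embedded into the crossed Burnside ring $B^c(\mathcal{G},S)$ of the $\mathcal{G}$-monoid $S$; that is, there is an injective ring homomorphism $B(\mathcal{G})\to B^c(\mathcal{G},S)$.
   Context: A groupoid is a category in which every morphism is invertible; it is finite if it has finitely many objects and morphisms. $\mathcal{G}_0$ is the set of objects. $\mathbf{set}$ is the category of finite sets and $\mathbf{mon}$ the category of finite monoids. $\mathbf{set}^{\mathcal{G}}$ is the category of functors $\mathcal{G}\to\mathbf{set}$ ($\mathcal{G}$-sets) and natural transformations ($\mathcal{G}$-maps). A $\mathcal{G}$-monoid is a functor $S:\mathcal{G}\to\mathbf{mon}$; $\overline{S}$ denotes its underlying $\mathcal{G}$-set (composite with the forgetful functor $\mathbf{mon}\to\mathbf{set}$). For a category with finite coproducts $\sqcup$ and a product operation distributing over them, its Grothendieck ring $K_0$ is the group completion of the commutative monoid of isomorphism classes under $\sqcup$, with multiplication induced by the product operation. The Burnside ring of $\mathcal{G}$ is $B(\mathcal{G}):=K_0(\mathbf{set}^{\mathcal{G}},\sqcup,\times)$, where $\times$ is the cartesian (objectwise) product. For a $\mathcal{G}$-monoid $S$, the slice category $\mathbf{set}^{\mathcal{G}}/\overline{S}$ is monoidal with $(\theta:X\to\overline{S})\otimes(\tau:Y\to\overline{S}):=(\theta\otimes\tau:X\times Y\to\overline{S})$, $(\theta\otimes\tau)_G(x,y)=\theta_G(x)\tau_G(y)$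 for $G\in\mathcal{G}_0$, with unit object $I:1\to\overline{S}$ picking out $1_{S(G)}$ at each $G$, and with associator and unitors inherited from the cartesian product. The crossed Burnside ring of the $\mathcal{G}$-monoid $S$ is $B^c(\mathcal{G},S):=K_0(\mathbf{set}^{\mathcal{G}}/\overline{S},\sqcup,\otimes)$. *)

theory Defs
  imports "HOL-Algebra.RingHom"
begin

section \<open>Finite groupoids\<close>

(* Comp C g f is the composite "g after f"; it is constrained only when Cod C f = Dom C g. *)
record ('o, 'a) cat =
  Obj :: "'o set"
  Arr :: "'a set"
  Dom :: "'a \<Rightarrow> 'o"
  Cod :: "'a \<Rightarrow> 'o"
  Ide :: "'o \<Rightarrow> 'a"
  Comp :: "'a \<Rightarrow> 'a \<Rightarrow> 'a"

locale category =
  fixes C :: "('o, 'a) cat"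
  assumes Dom_closed: "f \<in> Arr C \<Longrightarrow> Dom C f \<in> Obj C"
    and Cod_closed: "f \<in> Arr C \<Longrightarrow> Cod C f \<in> Obj C"
    and Ide_closed: "p \<in> Obj C \<Longrightarrow> Ide C p \<in> Arr C"
    and Dom_Ide: "p \<in> Obj C \<Longrightarrow> Dom C (Ide C p) = p"
    and Cod_Ide: "p \<in> Obj C \<Longrightarrow> Cod C (Ide C p) = p"
    and Comp_closed: "\<lbrakk>f \<in> Arr C; g \<in> Arr C; Cod C f = Dom C g\<rbrakk> \<Longrightarrow> Comp C g f \<in> Arr C"
    and Dom_Comp: "\<lbrakk>f \<in> Arr C; g \<in> Arr C; Cod C f = Dom C g\<rbrakk> \<Longrightarrow> Dom C (Comp C g f) = Dom C f"
    and Cod_Comp: "\<lbrakk>f \<in> Arr C; g \<in> Arr C; Cod C f = Dom C g\<rbrakk> \<Longrightarrow> Cod C (Comp C g f) = Cod C g"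
    and Comp_Ide_right: "f \<in> Arr C \<Longrightarrow> Comp C f (Ide C (Dom C f)) = f"
    and Comp_Ide_left: "f \<in> Arr C \<Longrightarrow> Comp C (Ide C (Cod C f)) f = f"
    and Comp_assoc: "\<lbrakk>f \<in> Arr C; g \<in> Arr C; h \<in> Arr C; Cod C f = Dom C g; Cod C g = Dom C h\<rbrakk>
          \<Longrightarrow> Comp C h (Comp C g f) = Comp C (Comp C h g) f"

locale groupoid = category +
  assumes invertible: "f \<in> Arr C \<Longrightarrow>
    \<exists>g \<in> Arr C. Dom C g = Cod C f \<and> Cod C g = Dom C f \<and>
      Comp C g f = Ide C (Dom C f) \<and> Comp C f g = Ide C (Cod C f)"

locale finite_groupoid = groupoid +
  assumes finite_Obj: "finite (Obj C)"
    and finite_Arr: "finite (Arr C)"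


section \<open>\<open>\<G>\<close>-sets and \<open>\<G>\<close>-maps\<close>

record ('o, 'a, 'x) gset =
  Fib :: "'o \<Rightarrow> 'x set"
  Act :: "'a \<Rightarrow> 'x \<Rightarrow> 'x"

(* Functors from G to finite sets. Values of Fib off Obj G, and of Act off Arr G or off
   the relevant fibre, are irrelevant: they are ignored by all notions below. *)
definition is_gset :: "('o, 'a) cat \<Rightarrow> ('o, 'a, 'x) gset \<Rightarrow> bool" where
  "is_gset G X \<longleftrightarrow>
     (\<forall>p \<in> Obj G. finite (Fib X p)) \<and>
     (\<forall>f \<in> Arr G. Act X f \<in> Fib X (Dom G f) \<rightarrow> Fib X (Cod G f)) \<and>
     (\<forall>p \<in> Obj G. \<forall>x \<in> Fib X p. Act X (Ide G p) x = x) \<and>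
     (\<forall>f \<in> Arr G. \<forall>g \<in> Arr G. Cod G f = Dom G g \<longrightarrow>
        (\<forall>x \<in> Fib X (Dom G f). Act X (Comp G g f) x = Act X g (Act X f x)))"

definition gmap ::
  "('o, 'a) cat \<Rightarrow> ('o, 'a, 'x) gset \<Rightarrow> ('o, 'a, 'y) gset \<Rightarrow> ('o \<Rightarrow> 'x \<Rightarrow> 'y) \<Rightarrow> bool" where
  "gmap G X Y h \<longleftrightarrow>
     (\<forall>p \<in> Obj G. h p \<in> Fib X p \<rightarrow> Fib Y p) \<and>
     (\<forall>f \<in> Arr G. \<forall>x \<in> Fib X (Dom G f). h (Cod G f) (Act X f x) = Act Y f (h (Dom G f) x))"

definition giso :: "('o, 'a) cat \<Rightarrow> ('o, 'a, 'x) gset \<Rightarrow> ('o, 'a, 'y) gset \<Rightarrow> bool" where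
  "giso G X Y \<longleftrightarrow> (\<exists>h k. gmap G X Y h \<and> gmap G Y X k \<and>
     (\<forall>p \<in> Obj G. (\<forall>x \<in> Fib X p. k p (h p x) = x) \<and> (\<forall>y \<in> Fib Y p. h p (k p y) = y)))"

definition gset_empty :: "('o, 'a, 'x) gset" where
  "gset_empty = \<lparr>Fib = (\<lambda>_. {}), Act = (\<lambda>_ x. x)\<rparr>"

definition gset_unit :: "('o, 'a, unit) gset" where
  "gset_unit = \<lparr>Fib = (\<lambda>_. {()}), Act = (\<lambda>_ x. x)\<rparr>"

definition gset_sum ::
  "('o, 'a, 'x) gset \<Rightarrow> ('o, 'a, 'y) gset \<Rightarrow> ('o, 'a, 'x + 'y) gset" where
  "gset_sum X Y = \<lparr>Fib = (\<lambda>p. Fib X p <+> Fib Y p), Act = (\<lambda>f. map_sum (Act X f) (Act Y f))\<rparr>"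

definition gset_prod ::
  "('o, 'a, 'x) gset \<Rightarrow> ('o, 'a, 'y) gset \<Rightarrow> ('o, 'a, 'x \<times> 'y) gset" where
  "gset_prod X Y = \<lparr>Fib = (\<lambda>p. Fib X p \<times> Fib Y p), Act = (\<lambda>f. map_prod (Act X f) (Act Y f))\<rparr>"


section \<open>\<open>\<G>\<close>-monoids and the slice category\<close>

record ('o, 'a, 'm) gmonoid =
  MObj :: "'o \<Rightarrow> 'm monoid"
  MAct :: "'a \<Rightarrow> 'm \<Rightarrow> 'm"

definition underlying :: "('o, 'a, 'm) gmonoid \<Rightarrow> ('o, 'a, 'm) gset" where
  "underlying S = \<lparr>Fib = (\<lambda>p. carrier (MObj S p)), Act = MAct S\<rparr>"

(* Functors from G to finite monoids. The set hom of HOL-Algebra does not require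
   preservation of the unit, so this is demanded separately. *)
definition is_gmonoid :: "('o, 'a) cat \<Rightarrow> ('o, 'a, 'm) gmonoid \<Rightarrow> bool" where
  "is_gmonoid G S \<longleftrightarrow>
     is_gset G (underlying S) \<and>
     (\<forall>p \<in> Obj G. Group.monoid (MObj S p)) \<and>
     (\<forall>f \<in> Arr G. MAct S f \<in> hom (MObj S (Dom G f)) (MObj S (Cod G f)) \<and>
        MAct S f (one (MObj S (Dom G f))) = one (MObj S (Cod G f)))"

(* Src is the domain of an object over T, Str its structure map to T. *)
record ('o, 'a, 'x, 't) slice =
  Src :: "('o, 'a, 'x) gset"
  Str :: "'o \<Rightarrow> 'x \<Rightarrow> 't"

definition is_slice :: "('o, 'a) cat \<Rightarrow> ('o, 'a, 't) gset \<Rightarrow> ('o, 'a, 'x, 't) slice \<Rightarrow> bool" where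
  "is_slice G T A \<longleftrightarrow> is_gset G (Src A) \<and> gmap G (Src A) T (Str A)"

definition slice_map ::
  "('o, 'a) cat \<Rightarrow> ('o, 'a, 'x, 't) slice \<Rightarrow> ('o, 'a, 'y, 't) slice \<Rightarrow> ('o \<Rightarrow> 'x \<Rightarrow> 'y) \<Rightarrow> bool" where
  "slice_map G A B h \<longleftrightarrow> gmap G (Src A) (Src B) h \<and>
     (\<forall>p \<in> Obj G. \<forall>x \<in> Fib (Src A) p. Str B p (h p x) = Str A p x)"

definition slice_iso ::
  "('o, 'a) cat \<Rightarrow> ('o, 'a, 'x, 't) slice \<Rightarrow> ('o, 'a, 'y, 't) slice \<Rightarrow> bool" where
  "slice_iso G A B \<longleftrightarrow> (\<exists>h k. slice_map G A B h \<and> slice_map G B A k \<and>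
     (\<forall>p \<in> Obj G. (\<forall>x \<in> Fib (Src A) p. k p (h p x) = x) \<and>
                   (\<forall>y \<in> Fib (Src B) p. h p (k p y) = y)))"

definition slice_empty :: "('o, 'a, 'x, 't) slice" where
  "slice_empty = \<lparr>Src = gset_empty, Str = (\<lambda>_ _. undefined)\<rparr>"

definition slice_sum ::
  "('o, 'a, 'x, 't) slice \<Rightarrow> ('o, 'a, 'y, 't) slice \<Rightarrow> ('o, 'a, 'x + 'y, 't) slice" where
  "slice_sum A B = \<lparr>Src = gset_sum (Src A) (Src B), Str = (\<lambda>p. case_sum (Str A p) (Str B p))\<rparr>"

definition slice_unit :: "('o, 'a, 'm) gmonoid \<Rightarrow> ('o, 'a, unit, 'm) slice" where
  "slice_unit S = \<lparr>Src = gset_unit, Str = (\<lambda>p _. one (MObj S p))\<rparr>"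

definition slice_tensor ::
  "('o, 'a, 'm) gmonoid \<Rightarrow> ('o, 'a, 'x, 'm) slice \<Rightarrow> ('o, 'a, 'y, 'm) slice
     \<Rightarrow> ('o, 'a, 'x \<times> 'y, 'm) slice" where
  "slice_tensor S A B = \<lparr>Src = gset_prod (Src A) (Src B),
     Str = (\<lambda>p (x, y). Str A p x \<otimes>\<^bsub>MObj S p\<^esub> Str B p y)\<rparr>"


section \<open>Semirings of isomorphism classes\<close>

(* An isomorphism class is represented by its members whose fibres are sets of natural numbers.
   No object is lost: every finite G-set, over any type, is isomorphic to one of these
   (gset_nat_model and slice_nat_model below). Isomorphism is defined between objects over
   different types, so sums and products need no encoding into nat. *)
definition gset_class :: "('o, 'a) cat \<Rightarrow> ('o, 'a, 'x) gset \<Rightarrow> ('o, 'a, nat) gset set" where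
  "gset_class G X = {Z. is_gset G Z \<and> giso G Z X}"

definition slice_class ::
  "('o, 'a) cat \<Rightarrow> ('o, 'a, 't) gset \<Rightarrow> ('o, 'a, 'x, 't) slice \<Rightarrow> ('o, 'a, nat, 't) slice set" where
  "slice_class G T A = {Z. is_slice G T Z \<and> slice_iso G Z A}"

lemma finite_fibres_nat_code:
  assumes "is_gset G X"
  obtains e :: "'o \<Rightarrow> 'x \<Rightarrow> nat" where "\<And>p. p \<in> Obj G \<Longrightarrow> inj_on (e p) (Fib X p)"
proof -
  have "\<forall>p. \<exists>e :: 'x \<Rightarrow> nat. p \<in> Obj G \<longrightarrow> inj_on e (Fib X p)"
    using assms finite_imp_inj_to_nat_seg unfolding is_gset_def by metis
  then show thesis
    using that by metis
qed

lemma (in category) slice_nat_model: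
  fixes A :: "('o, 'a, 'x, 't) slice"
  assumes A: "is_slice C T A"
  shows "slice_class C T A \<noteq> {}"
proof -
  define X where "X = Src A"
  have X: "is_gset C X" and str: "gmap C X T (Str A)"
    using A by (auto simp: is_slice_def X_def)
  obtain e :: "'o \<Rightarrow> 'x \<Rightarrow> nat" where e: "\<And>p. p \<in> Obj C \<Longrightarrow> inj_on (e p) (Fib X p)"
    using finite_fibres_nat_code[OF X] by blast
  define d where "d p = inv_into (Fib X p) (e p)" for p
  have d: "d p (e p x) = x" if "p \<in> Obj C" "x \<in> Fib X p" for p x
    using that e by (simp add: d_def)
  define Z :: "('o, 'a, nat, 't) slice" where
    "Z = \<lparr>Src = \<lparr>Fib = (\<lambda>p. e p ` Fib X p),
               Act = (\<lambda>f n. e (Cod C f) (Act X f (d (Dom C f) n)))\<rparr>,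
          Str = (\<lambda>p n. Str A p (d p n))\<rparr>"
  have act: "Act X f x \<in> Fib X (Cod C f)" if "f \<in> Arr C" "x \<in> Fib X (Dom C f)" for f x
    using X that unfolding is_gset_def by blast
  have "is_gset C (Src Z)"
    using X act
    by (auto simp: Z_def is_gset_def d Dom_closed Cod_closed Ide_closed Dom_Ide Cod_Ide
        Dom_Comp Cod_Comp Comp_closed)
      (metis Cod_closed act d)
  moreover have "gmap C (Src Z) T (Str Z)"
    using str by (auto simp: Z_def gmap_def Pi_def d Dom_closed Cod_closed act)
  moreover have "slice_iso C Z A"
    unfolding slice_iso_def
    by (rule exI[of _ d], rule exI[of _ e])
      (auto simp: Z_def slice_map_def gmap_def d act Dom_closed Cod_closed X_def[symmetric])
  ultimately show ?thesis
    by (auto simp: slice_class_def is_slice_def)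
qed

lemma (in category) gset_nat_model:
  assumes "is_gset C X"
  shows "gset_class C X \<noteq> {}"
proof -
  define T :: "('o, 'a, unit) gset" where "T = gset_unit"
  have "is_slice C T \<lparr>Src = X, Str = (\<lambda>_ _. ())\<rparr>"
    using assms by (auto simp: is_slice_def gmap_def T_def gset_unit_def)
  then obtain Z :: "('o, 'a, nat, unit) slice"
    where "is_slice C T Z" "slice_iso C Z \<lparr>Src = X, Str = (\<lambda>_ _. ())\<rparr>"
    using slice_nat_model unfolding slice_class_def by blast
  then have "Src Z \<in> gset_class C X"
    by (auto simp: gset_class_def is_slice_def slice_iso_def slice_map_def giso_def)
  then show ?thesis by blast
qed

(* The record type "ring" of HOL-Algebra serves here as a carrier of signature only. *)
definition gset_semiring :: "('o, 'a) cat \<Rightarrow> ('o, 'a, nat) gset set ring" where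
  "gset_semiring G = \<lparr>
     carrier = {gset_class G X | X :: ('o, 'a, nat) gset. is_gset G X},
     mult = (\<lambda>P Q. \<Union>X \<in> P. \<Union>Y \<in> Q. gset_class G (gset_prod X Y)),
     one = gset_class G gset_unit,
     zero = gset_class G (gset_empty :: ('o, 'a, nat) gset),
     add = (\<lambda>P Q. \<Union>X \<in> P. \<Union>Y \<in> Q. gset_class G (gset_sum X Y))\<rparr>"

definition crossed_semiring ::
  "('o, 'a) cat \<Rightarrow> ('o, 'a, 'm) gmonoid \<Rightarrow> ('o, 'a, nat, 'm) slice set ring" where
  "crossed_semiring G S = \<lparr>
     carrier = {slice_class G (underlying S) A | A :: ('o, 'a, nat, 'm) slice.
                  is_slice G (underlying S) A},
     mult = (\<lambda>P Q. \<Union>A \<in> P. \<Union>B \<in> Q. slice_class G (underlying S) (slice_tensor S A B)),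
     one = slice_class G (underlying S) (slice_unit S),
     zero = slice_class G (underlying S) (slice_empty :: ('o, 'a, nat, 'm) slice),
     add = (\<lambda>P Q. \<Union>A \<in> P. \<Union>B \<in> Q. slice_class G (underlying S) (slice_sum A B))\<rparr>"


section \<open>Group completion and Burnside rings\<close>

(* (a, b) stands for the formal difference a - b. *)
definition diff_rel :: "('c, 'z) ring_scheme \<Rightarrow> (('c \<times> 'c) \<times> ('c \<times> 'c)) set" where
  "diff_rel R = {((a, b), (c, d)). a \<in> carrier R \<and> b \<in> carrier R \<and> c \<in> carrier R \<and> d \<in> carrier R \<and>
     (\<exists>k \<in> carrier R. (a \<oplus>\<^bsub>R\<^esub> d) \<oplus>\<^bsub>R\<^esub> k = (c \<oplus>\<^bsub>R\<^esub> b) \<oplus>\<^bsub>R\<^esub> k)}"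

definition completion :: "('c, 'z) ring_scheme \<Rightarrow> ('c \<times> 'c) set ring" where
  "completion R = \<lparr>
     carrier = (carrier R \<times> carrier R) // diff_rel R,
     mult = (\<lambda>P Q. \<Union>(a, b) \<in> P. \<Union>(c, d) \<in> Q.
       diff_rel R `` {((a \<otimes>\<^bsub>R\<^esub> c) \<oplus>\<^bsub>R\<^esub> (b \<otimes>\<^bsub>R\<^esub> d), (a \<otimes>\<^bsub>R\<^esub> d) \<oplus>\<^bsub>R\<^esub> (b \<otimes>\<^bsub>R\<^esub> c))}),
     one = diff_rel R `` {(\<one>\<^bsub>R\<^esub>, \<zero>\<^bsub>R\<^esub>)},
     zero = diff_rel R `` {(\<zero>\<^bsub>R\<^esub>, \<zero>\<^bsub>R\<^esub>)},
     add = (\<lambda>P Q. \<Union>(a, b) \<in> P. \<Union>(c, d) \<in> Q. diff_rel R `` {(a \<oplus>\<^bsub>R\<^esub> c, b \<oplus>\<^bsub>R\<^esub> d)})\<rparr>"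

definition burnside_ring ::
  "('o, 'a) cat \<Rightarrow> (('o, 'a, nat) gset set \<times> ('o, 'a, nat) gset set) set ring" where
  "burnside_ring G = completion (gset_semiring G)"

definition crossed_burnside_ring ::
  "('o, 'a) cat \<Rightarrow> ('o, 'a, 'm) gmonoid
     \<Rightarrow> (('o, 'a, nat, 'm) slice set \<times> ('o, 'a, nat, 'm) slice set) set ring" where
  "crossed_burnside_ring G S = completion (crossed_semiring G S)"

end

theory Submission
  imports Defs
begin

text \<open>The embedding sends a \<open>\<G>\<close>-set \<open>X\<close> to the slice \<open>X \<rightarrow> S\<close> whose structure map is constantly the unit
  of the monoid in each fibre. This constant map is a \<open>\<G>\<close>-map because \<open>S\<close> acts by unital homomorphisms;
  it preserves sums for trivial reasons, and products because \<open>1 \<cdot> 1 = 1\<close>. So it induces a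
  homomorphism from the semiring of isomorphism classes of \<open>\<G>\<close>-sets to that of slices over \<open>S\<close>
  (\<open>embed_class_ring_hom\<close>), and by functoriality of the group completion a ring homomorphism of the
  Burnside rings (\<open>completion_map_ring_hom\<close>).

  Injectivity comes from the functor that forgets the structure map. It preserves sums and recovers
  \<open>X\<close> from the constant slice on it. It therefore induces an additive
  left inverse on the completions (\<open>completion_map_inj\<close>).

  It remains to see that both completions are rings. The completion of any semiring, commutative
  or not, is a ring (\<open>ring_completion\<close>). The classes of slices form a semiring by the usual
  structural isomorphisms for sums and tensor products (\<open>semiring_crossed\<close>), and the classes of
  \<open>\<G>\<close>-sets inherit the semiring axioms along the embedding just described (\<open>semiring_gset\<close>).\<close>

section \<open>The group completion of a semiring\<close>

abbreviation formal_diff :: "('c, 'z) ring_scheme \<Rightarrow> 'c \<Rightarrow> 'c \<Rightarrow> ('c \<times> 'c) set" where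
  "formal_diff R a b \<equiv> diff_rel R `` {(a, b)}"

context semiring
begin

lemma diff_relI:
  assumes "a \<in> carrier R" "b \<in> carrier R" "c \<in> carrier R" "d \<in> carrier R" "k \<in> carrier R"
    and "a \<oplus> d \<oplus> k = c \<oplus> b \<oplus> k"
  shows "((a, b), (c, d)) \<in> diff_rel R"
  using assms by (auto simp: diff_rel_def)

text \<open>Only transitivity needs care: addition is not assumed cancellative, so the terms that the two
  witnessing equations share cannot be removed from a combination of them. They become part of the
  witness \<open>d + k + l\<close>.\<close>

lemma equiv_diff_rel: "equiv (carrier R \<times> carrier R) (diff_rel R)"
proof (rule equivI)
  show "diff_rel R \<subseteq> (carrier R \<times> carrier R) \<times> (carrier R \<times> carrier R)"
    by (auto simp: diff_rel_def)
  show "refl_on (carrier R \<times> carrier R) (diff_rel R)"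
    by (rule refl_onI) (auto simp: diff_rel_def)
  show "sym (diff_rel R)"
    by (rule symI) (auto simp: diff_rel_def, metis)
  show "trans (diff_rel R)"
  proof (rule transI, clarify)
    fix a b c d e f
    assume "((a, b), (c, d)) \<in> diff_rel R" "((c, d), (e, f)) \<in> diff_rel R"
    then obtain k l
      where carr: "a \<in> carrier R" "b \<in> carrier R" "c \<in> carrier R" "d \<in> carrier R"
          "e \<in> carrier R" "f \<in> carrier R" "k \<in> carrier R" "l \<in> carrier R"
        and k: "a \<oplus> d \<oplus> k = c \<oplus> b \<oplus> k" and l: "c \<oplus> f \<oplus> l = e \<oplus> d \<oplus> l"
      by (auto simp: diff_rel_def)
    have "a \<oplus> f \<oplus> (d \<oplus> k \<oplus> l) = (a \<oplus> d \<oplus> k) \<oplus> (f \<oplus> l)"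
      using carr by (simp add: a_ac)
    also have "\<dots> = (c \<oplus> f \<oplus> l) \<oplus> (b \<oplus> k)"
      unfolding k using carr by (simp add: a_ac)
    also have "\<dots> = e \<oplus> b \<oplus> (d \<oplus> k \<oplus> l)"
      unfolding l using carr by (simp add: a_ac)
    finally show "((a, b), (e, f)) \<in> diff_rel R"
      using carr by (intro diff_relI[where k = "d \<oplus> k \<oplus> l"]) auto
  qed
qed

lemma formal_diff_eq_iff:
  assumes "a \<in> carrier R" "b \<in> carrier R" "c \<in> carrier R" "d \<in> carrier R"
  shows "formal_diff R a b = formal_diff R c d \<longleftrightarrow>
    (\<exists>k \<in> carrier R. a \<oplus> d \<oplus> k = c \<oplus> b \<oplus> k)"
  using eq_equiv_class_iff[OF equiv_diff_rel, of "(a, b)" "(c, d)"] assms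
  by (auto simp: diff_rel_def)

lemma formal_diff_eqI:
  assumes "((a, b), (c, d)) \<in> diff_rel R"
  shows "formal_diff R a b = formal_diff R c d"
  using equiv_class_eq[OF equiv_diff_rel assms] .

lemma carrier_completion:
  "carrier (completion R) = {formal_diff R a b |a b. a \<in> carrier R \<and> b \<in> carrier R}"
  by (auto simp: completion_def quotient_def)

lemma completionE:
  assumes "P \<in> carrier (completion R)"
  obtains a b where "a \<in> carrier R" "b \<in> carrier R" "P = formal_diff R a b"
  using assms by (auto simp: carrier_completion)

lemma formal_diff_closed:
  "\<lbrakk>a \<in> carrier R; b \<in> carrier R\<rbrakk> \<Longrightarrow> formal_diff R a b \<in> carrier (completion R)"
  by (auto simp: carrier_completion)

text \<open>The operations of the completion are unions over all representatives. This lemma turns the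
  independence of the representative into an evaluation rule for such unions.\<close>

lemma UN_formal_diff:
  assumes "a \<in> carrier R" "b \<in> carrier R"
    and "\<And>a' b'. ((a, b), (a', b')) \<in> diff_rel R \<Longrightarrow> F a' b' = V"
  shows "(\<Union>(a', b') \<in> formal_diff R a b. F a' b') = V"
proof -
  have "(a, b) \<in> formal_diff R a b"
    using assms(1,2) equiv_class_self[OF equiv_diff_rel] by blast
  then show ?thesis
    using assms(3) by (intro UN_constant_eq[of "(a, b)"]) auto
qed

lemma add_formal_diff:
  assumes carr: "a \<in> carrier R" "b \<in> carrier R" "c \<in> carrier R" "d \<in> carrier R"
  shows "formal_diff R a b \<oplus>\<^bsub>completion R\<^esub> formal_diff R c d = formal_diff R (a \<oplus> c) (b \<oplus> d)"
proof -
  have "formal_diff R (a' \<oplus> c') (b' \<oplus> d') = formal_diff R (a \<oplus> c) (b \<oplus> d)"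
    if 1: "((a, b), (a', b')) \<in> diff_rel R" and 2: "((c, d), (c', d')) \<in> diff_rel R" for a' b' c' d'
  proof -
    obtain k l where carr': "a' \<in> carrier R" "b' \<in> carrier R" "c' \<in> carrier R" "d' \<in> carrier R"
        "k \<in> carrier R" "l \<in> carrier R"
      and k: "a \<oplus> b' \<oplus> k = a' \<oplus> b \<oplus> k" and l: "c \<oplus> d' \<oplus> l = c' \<oplus> d \<oplus> l"
      using 1 2 by (auto simp: diff_rel_def)
    have "(a \<oplus> c) \<oplus> (b' \<oplus> d') \<oplus> (k \<oplus> l) = (a \<oplus> b' \<oplus> k) \<oplus> (c \<oplus> d' \<oplus> l)"
      using carr carr' by (simp add: a_ac)
    also have "\<dots> = (a' \<oplus> c') \<oplus> (b \<oplus> d) \<oplus> (k \<oplus> l)"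
      unfolding k l using carr carr' by (simp add: a_ac)
    finally show ?thesis
      using carr carr' by (intro formal_diff_eqI[symmetric] diff_relI[where k = "k \<oplus> l"]) auto
  qed
  then have "(\<Union>(a', b') \<in> formal_diff R a b. \<Union>(c', d') \<in> formal_diff R c d.
      formal_diff R (a' \<oplus> c') (b' \<oplus> d')) = formal_diff R (a \<oplus> c) (b \<oplus> d)"
    using carr by (intro UN_formal_diff) auto
  then show ?thesis by (simp add: completion_def)
qed

text \<open>Without additive inverses one cannot subtract inside the product. Instead the witnessing equation
  \<open>a + b' + k = a' + b + k\<close> is multiplied once by \<open>c\<close> from left to right and once by \<open>d\<close> from right
  to left, and the two results are added; the spare terms \<open>k c + k d\<close> are the new witness. Both
  factors are treated separately, as multiplication need not commute.\<close>

lemma mult_diff_rel_left: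
  assumes "((a, b), (a', b')) \<in> diff_rel R" and carr: "c \<in> carrier R" "d \<in> carrier R"
  shows "((a \<otimes> c \<oplus> b \<otimes> d, a \<otimes> d \<oplus> b \<otimes> c), (a' \<otimes> c \<oplus> b' \<otimes> d, a' \<otimes> d \<oplus> b' \<otimes> c)) \<in> diff_rel R"
proof -
  obtain k where carr': "a \<in> carrier R" "b \<in> carrier R" "a' \<in> carrier R" "b' \<in> carrier R"
      "k \<in> carrier R" and k: "a \<oplus> b' \<oplus> k = a' \<oplus> b \<oplus> k"
    using assms(1) by (auto simp: diff_rel_def)
  have "(a \<otimes> c \<oplus> b \<otimes> d) \<oplus> (a' \<otimes> d \<oplus> b' \<otimes> c) \<oplus> (k \<otimes> c \<oplus> k \<otimes> d)
      = (a \<oplus> b' \<oplus> k) \<otimes> c \<oplus> (a' \<oplus> b \<oplus> k) \<otimes> d"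
    using carr carr' by (simp add: l_distr a_ac)
  also have "\<dots> = (a' \<oplus> b \<oplus> k) \<otimes> c \<oplus> (a \<oplus> b' \<oplus> k) \<otimes> d"
    unfolding k ..
  also have "\<dots> = (a' \<otimes> c \<oplus> b' \<otimes> d) \<oplus> (a \<otimes> d \<oplus> b \<otimes> c) \<oplus> (k \<otimes> c \<oplus> k \<otimes> d)"
    using carr carr' by (simp add: l_distr a_ac)
  finally show ?thesis
    using carr carr' by (intro diff_relI[where k = "k \<otimes> c \<oplus> k \<otimes> d"]) auto
qed

lemma mult_diff_rel_right:
  assumes "((c, d), (c', d')) \<in> diff_rel R" and carr: "a \<in> carrier R" "b \<in> carrier R"
  shows "((a \<otimes> c \<oplus> b \<otimes> d, a \<otimes> d \<oplus> b \<otimes> c), (a \<otimes> c' \<oplus> b \<otimes> d', a \<otimes> d' \<oplus> b \<otimes> c')) \<in> diff_rel R"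
proof -
  obtain k where carr': "c \<in> carrier R" "d \<in> carrier R" "c' \<in> carrier R" "d' \<in> carrier R"
      "k \<in> carrier R" and k: "c \<oplus> d' \<oplus> k = c' \<oplus> d \<oplus> k"
    using assms(1) by (auto simp: diff_rel_def)
  have "(a \<otimes> c \<oplus> b \<otimes> d) \<oplus> (a \<otimes> d' \<oplus> b \<otimes> c') \<oplus> (a \<otimes> k \<oplus> b \<otimes> k)
      = a \<otimes> (c \<oplus> d' \<oplus> k) \<oplus> b \<otimes> (c' \<oplus> d \<oplus> k)"
    using carr carr' by (simp add: r_distr a_ac)
  also have "\<dots> = a \<otimes> (c' \<oplus> d \<oplus> k) \<oplus> b \<otimes> (c \<oplus> d' \<oplus> k)"
    unfolding k ..
  also have "\<dots> = (a \<otimes> c' \<oplus> b \<otimes> d') \<oplus> (a \<otimes> d \<oplus> b \<otimes> c) \<oplus> (a \<otimes> k \<oplus> b \<otimes> k)"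
    using carr carr' by (simp add: r_distr a_ac)
  finally show ?thesis
    using carr carr' by (intro diff_relI[where k = "a \<otimes> k \<oplus> b \<otimes> k"]) auto
qed

lemma mult_formal_diff:
  assumes carr: "a \<in> carrier R" "b \<in> carrier R" "c \<in> carrier R" "d \<in> carrier R"
  shows "formal_diff R a b \<otimes>\<^bsub>completion R\<^esub> formal_diff R c d
    = formal_diff R (a \<otimes> c \<oplus> b \<otimes> d) (a \<otimes> d \<oplus> b \<otimes> c)"
proof -
  have "formal_diff R (a' \<otimes> c' \<oplus> b' \<otimes> d') (a' \<otimes> d' \<oplus> b' \<otimes> c')
      = formal_diff R (a \<otimes> c \<oplus> b \<otimes> d) (a \<otimes> d \<oplus> b \<otimes> c)"
    if 1: "((a, b), (a', b')) \<in> diff_rel R" and 2: "((c, d), (c', d')) \<in> diff_rel R" for a' b' c' d'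
  proof -
    have "c' \<in> carrier R" "d' \<in> carrier R"
      using 2 by (auto simp: diff_rel_def)
    then show ?thesis
      using formal_diff_eqI[OF mult_diff_rel_left[OF 1]] formal_diff_eqI[OF mult_diff_rel_right[OF 2]]
        carr by simp
  qed
  then have "(\<Union>(a', b') \<in> formal_diff R a b. \<Union>(c', d') \<in> formal_diff R c d.
      formal_diff R (a' \<otimes> c' \<oplus> b' \<otimes> d') (a' \<otimes> d' \<oplus> b' \<otimes> c'))
      = formal_diff R (a \<otimes> c \<oplus> b \<otimes> d) (a \<otimes> d \<oplus> b \<otimes> c)"
    using carr by (intro UN_formal_diff) auto
  then show ?thesis by (simp add: completion_def)
qed

lemma zero_completion: "\<zero>\<^bsub>completion R\<^esub> = formal_diff R \<zero> \<zero>"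
  and one_completion: "\<one>\<^bsub>completion R\<^esub> = formal_diff R \<one> \<zero>"
  by (simp_all add: completion_def)

text \<open>The inverse of the formal difference of \<open>a\<close> and \<open>b\<close> is that of \<open>b\<close> and \<open>a\<close>; every other axiom
  already holds at the level of representatives.\<close>

theorem ring_completion: "ring (completion R)"
proof (rule ringI)
  note completion_simps = add_formal_diff mult_formal_diff zero_completion one_completion
    formal_diff_closed
  show "abelian_group (completion R)"
  proof (rule abelian_groupI)
    fix P assume "P \<in> carrier (completion R)"
    then obtain a b where ab: "a \<in> carrier R" "b \<in> carrier R" "P = formal_diff R a b"
      by (rule completionE)
    have "formal_diff R b a \<oplus>\<^bsub>completion R\<^esub> P = \<zero>\<^bsub>completion R\<^esub>"
      using ab by (auto simp: completion_simps formal_diff_eq_iff a_comm intro!: bexI[of _ \<zero>])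
    then show "\<exists>Q \<in> carrier (completion R). Q \<oplus>\<^bsub>completion R\<^esub> P = \<zero>\<^bsub>completion R\<^esub>"
      using ab formal_diff_closed by blast
  qed (auto elim!: completionE simp: completion_simps a_ac)
  show "monoid (completion R)"
    by (rule monoidI) (auto elim!: completionE simp: completion_simps l_distr r_distr m_assoc a_ac)
qed (auto elim!: completionE simp: add_formal_diff mult_formal_diff l_distr r_distr a_ac)

end

section \<open>Functoriality of the completion\<close>

definition completion_map :: "('c, 'z) ring_scheme \<Rightarrow> ('d, 'y) ring_scheme \<Rightarrow> ('c \<Rightarrow> 'd)
    \<Rightarrow> ('c \<times> 'c) set \<Rightarrow> ('d \<times> 'd) set" where
  "completion_map R R' \<phi> P = (\<Union>(a, b) \<in> P. formal_diff R' (\<phi> a) (\<phi> b))"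

lemma completion_map_formal_diff:
  assumes "semiring R" "semiring R'" and \<phi>: "\<phi> \<in> ring_hom R R'"
    and carr: "a \<in> carrier R" "b \<in> carrier R"
  shows "completion_map R R' \<phi> (formal_diff R a b) = formal_diff R' (\<phi> a) (\<phi> b)"
proof -
  interpret R: semiring R by fact
  interpret R': semiring R' by fact
  show ?thesis
    unfolding completion_map_def
  proof (rule R.UN_formal_diff[OF carr])
    fix a' b' assume "((a, b), (a', b')) \<in> diff_rel R"
    then obtain k where carr': "a' \<in> carrier R" "b' \<in> carrier R" "k \<in> carrier R"
      and k: "a \<oplus>\<^bsub>R\<^esub> b' \<oplus>\<^bsub>R\<^esub> k = a' \<oplus>\<^bsub>R\<^esub> b \<oplus>\<^bsub>R\<^esub> k"
      by (auto simp: diff_rel_def)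
    have "\<phi> (a \<oplus>\<^bsub>R\<^esub> b' \<oplus>\<^bsub>R\<^esub> k) = \<phi> (a' \<oplus>\<^bsub>R\<^esub> b \<oplus>\<^bsub>R\<^esub> k)"
      using k by simp
    then have "\<phi> a \<oplus>\<^bsub>R'\<^esub> \<phi> b' \<oplus>\<^bsub>R'\<^esub> \<phi> k = \<phi> a' \<oplus>\<^bsub>R'\<^esub> \<phi> b \<oplus>\<^bsub>R'\<^esub> \<phi> k"
      using carr carr' by (simp add: ring_hom_add[OF \<phi>])
    then show "formal_diff R' (\<phi> a') (\<phi> b') = formal_diff R' (\<phi> a) (\<phi> b)"
      using carr carr' ring_hom_closed[OF \<phi>]
      by (intro R'.formal_diff_eqI[symmetric] R'.diff_relI[where k = "\<phi> k"]) auto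
  qed
qed

lemma completion_map_ring_hom:
  assumes R: "semiring R" and R': "semiring R'" and \<phi>: "\<phi> \<in> ring_hom R R'"
    and zero: "\<phi> \<zero>\<^bsub>R\<^esub> = \<zero>\<^bsub>R'\<^esub>"
  shows "ring_hom_ring (completion R) (completion R') (completion_map R R' \<phi>)"
proof -
  interpret R: semiring R by fact
  interpret R': semiring R' by fact
  note simps = completion_map_formal_diff[OF R R' \<phi>] ring_hom_closed[OF \<phi>] ring_hom_add[OF \<phi>]
    ring_hom_mult[OF \<phi>] ring_hom_one[OF \<phi>] zero
  show ?thesis
    by (rule ring_hom_ringI[OF R.ring_completion R'.ring_completion])
      (auto elim!: R.completionE simp: simps R.add_formal_diff R'.add_formal_diff
        R.mult_formal_diff R'.mult_formal_diff R'.formal_diff_closed R.one_completion R'.one_completion)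
qed

text \<open>A homomorphism that is injective on a semiring need not stay injective on the completion, since
  new cancellations can occur in the larger semiring. An additive retraction \<open>\<psi>\<close> excludes this: it
  carries a cancellation witness \<open>k\<close> back to the witness \<open>\<psi> k\<close>.\<close>

lemma completion_map_inj:
  assumes R: "semiring R" and R': "semiring R'" and \<phi>: "\<phi> \<in> ring_hom R R'"
    and \<psi>: "\<psi> \<in> carrier R' \<rightarrow> carrier R"
    and \<psi>_add: "\<And>x y. \<lbrakk>x \<in> carrier R'; y \<in> carrier R'\<rbrakk> \<Longrightarrow> \<psi> (x \<oplus>\<^bsub>R'\<^esub> y) = \<psi> x \<oplus>\<^bsub>R\<^esub> \<psi> y"
    and retract: "\<And>x. x \<in> carrier R \<Longrightarrow> \<psi> (\<phi> x) = x"
  shows "inj_on (completion_map R R' \<phi>) (carrier (completion R))"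
proof (rule inj_onI)
  interpret R: semiring R by fact
  interpret R': semiring R' by fact
  fix P Q
  assume "P \<in> carrier (completion R)" "Q \<in> carrier (completion R)"
    and eq: "completion_map R R' \<phi> P = completion_map R R' \<phi> Q"
  then obtain a b c d where carr: "a \<in> carrier R" "b \<in> carrier R" "c \<in> carrier R" "d \<in> carrier R"
    and PQ: "P = formal_diff R a b" "Q = formal_diff R c d"
    by (metis R.completionE)
  note clos = carr ring_hom_closed[OF \<phi>]
  obtain k where k: "k \<in> carrier R'"
      "\<phi> a \<oplus>\<^bsub>R'\<^esub> \<phi> d \<oplus>\<^bsub>R'\<^esub> k = \<phi> c \<oplus>\<^bsub>R'\<^esub> \<phi> b \<oplus>\<^bsub>R'\<^esub> k"
    using eq clos by (auto simp: PQ completion_map_formal_diff[OF R R' \<phi>] R'.formal_diff_eq_iff)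
  have "\<psi> (\<phi> a \<oplus>\<^bsub>R'\<^esub> \<phi> d \<oplus>\<^bsub>R'\<^esub> k) = \<psi> (\<phi> c \<oplus>\<^bsub>R'\<^esub> \<phi> b \<oplus>\<^bsub>R'\<^esub> k)"
    using k by simp
  then have "a \<oplus>\<^bsub>R\<^esub> d \<oplus>\<^bsub>R\<^esub> \<psi> k = c \<oplus>\<^bsub>R\<^esub> b \<oplus>\<^bsub>R\<^esub> \<psi> k"
    using clos k(1) by (simp add: \<psi>_add retract)
  then show "P = Q"
    using carr k(1) \<psi> unfolding PQ
    by (intro R.formal_diff_eqI R.diff_relI[where k = "\<psi> k"]) auto
qed

text \<open>The semiring axioms are universally quantified equations, so they are inherited along an injection
  that preserves the operations.\<close>

lemma semiring_pullback:
  assumes "semiring R'" and \<phi>: "\<phi> \<in> ring_hom R R'" and inj: "inj_on \<phi> (carrier R)"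
    and zero: "\<phi> \<zero>\<^bsub>R\<^esub> = \<zero>\<^bsub>R'\<^esub>"
    and closed: "\<zero>\<^bsub>R\<^esub> \<in> carrier R" "\<one>\<^bsub>R\<^esub> \<in> carrier R"
      "\<And>x y. \<lbrakk>x \<in> carrier R; y \<in> carrier R\<rbrakk> \<Longrightarrow> x \<oplus>\<^bsub>R\<^esub> y \<in> carrier R"
      "\<And>x y. \<lbrakk>x \<in> carrier R; y \<in> carrier R\<rbrakk> \<Longrightarrow> x \<otimes>\<^bsub>R\<^esub> y \<in> carrier R"
  shows "semiring R"
proof -
  interpret R': semiring R' by fact
  note simps = ring_hom_closed[OF \<phi>] ring_hom_add[OF \<phi>]
    ring_hom_mult[OF \<phi>] ring_hom_one[OF \<phi>] zero closed
  note inj = inj_onD[OF inj]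
  have "abelian_monoid R"
    by (rule abelian_monoidI; (rule inj)?) (simp_all add: simps R'.a_ac)
  moreover have "monoid R"
    by (rule monoidI; (rule inj)?) (simp_all add: simps R'.m_assoc)
  moreover have "semiring_axioms R"
    by (rule semiring_axioms.intro; rule inj) (simp_all add: simps R'.l_distr R'.r_distr)
  ultimately show ?thesis
    by (rule semiring.intro)
qed

section \<open>Isomorphism classes of slices\<close>

context category
begin

lemma slice_iso_sym: "slice_iso C A B \<Longrightarrow> slice_iso C B A"
  unfolding slice_iso_def by blast

lemma slice_map_comp:
  "\<lbrakk>slice_map C A B h; slice_map C B D h'\<rbrakk> \<Longrightarrow> slice_map C A D (\<lambda>p x. h' p (h p x))"
  by (auto simp: slice_map_def gmap_def Pi_iff Dom_closed)

lemma slice_iso_trans: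
  assumes "slice_iso C A B" "slice_iso C B D"
  shows "slice_iso C A D"
proof -
  obtain h k where AB: "slice_map C A B h" "slice_map C B A k"
    "\<forall>p \<in> Obj C. (\<forall>x \<in> Fib (Src A) p. k p (h p x) = x) \<and> (\<forall>y \<in> Fib (Src B) p. h p (k p y) = y)"
    using assms(1) unfolding slice_iso_def by blast
  obtain h' k' where BD: "slice_map C B D h'" "slice_map C D B k'"
    "\<forall>p \<in> Obj C. (\<forall>x \<in> Fib (Src B) p. k' p (h' p x) = x) \<and> (\<forall>y \<in> Fib (Src D) p. h' p (k' p y) = y)"
    using assms(2) unfolding slice_iso_def by blast
  have "h p x \<in> Fib (Src B) p" if "p \<in> Obj C" "x \<in> Fib (Src A) p" for p x
    using AB(1) that by (auto simp: slice_map_def gmap_def)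
  moreover have "k' p x \<in> Fib (Src B) p" if "p \<in> Obj C" "x \<in> Fib (Src D) p" for p x
    using BD(2) that by (auto simp: slice_map_def gmap_def)
  ultimately show ?thesis
    unfolding slice_iso_def
    using slice_map_comp[OF AB(1) BD(1)] slice_map_comp[OF BD(2) AB(2)] AB(3) BD(3)
    by (intro exI[of _ "\<lambda>p x. h' p (h p x)"] exI[of _ "\<lambda>p x. k p (k' p x)"]) simp
qed

text \<open>The data of an isomorphism with the redundant conditions dropped: the map \<open>k\<close> is only required to
  be a fibrewise inverse of \<open>h\<close>. This keeps the verification of each structural isomorphism below short.\<close>

definition iso_pair :: "('o, 'a, 'x, 't) slice \<Rightarrow> ('o, 'a, 'y, 't) slice
    \<Rightarrow> ('o \<Rightarrow> 'x \<Rightarrow> 'y) \<Rightarrow> ('o \<Rightarrow> 'y \<Rightarrow> 'x) \<Rightarrow> bool" where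
  "iso_pair A B h k \<longleftrightarrow>
     (\<forall>p \<in> Obj C. \<forall>x \<in> Fib (Src A) p.
        h p x \<in> Fib (Src B) p \<and> Str B p (h p x) = Str A p x \<and> k p (h p x) = x) \<and>
     (\<forall>f \<in> Arr C. \<forall>x \<in> Fib (Src A) (Dom C f).
        h (Cod C f) (Act (Src A) f x) = Act (Src B) f (h (Dom C f) x)) \<and>
     (\<forall>p \<in> Obj C. \<forall>y \<in> Fib (Src B) p. k p y \<in> Fib (Src A) p \<and> h p (k p y) = y)"

text \<open>A fibrewise inverse of an equivariant map over \<open>T\<close> is itself equivariant and over \<open>T\<close>.\<close>

lemma slice_iso_if_iso_pair:
  assumes A: "is_slice C T A" and pair: "iso_pair A B h k"
  shows "slice_iso C A B"
proof -
  have h: "h p x \<in> Fib (Src B) p" "Str B p (h p x) = Str A p x" "k p (h p x) = x"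
    if "p \<in> Obj C" "x \<in> Fib (Src A) p" for p x
    using pair that by (simp_all add: iso_pair_def)
  have act: "h (Cod C f) (Act (Src A) f x) = Act (Src B) f (h (Dom C f) x)"
    if "f \<in> Arr C" "x \<in> Fib (Src A) (Dom C f)" for f x
    using pair that by (simp add: iso_pair_def)
  have k: "k p y \<in> Fib (Src A) p" "h p (k p y) = y" if "p \<in> Obj C" "y \<in> Fib (Src B) p" for p y
    using pair that by (simp_all add: iso_pair_def)
  have "k (Cod C f) (Act (Src B) f y) = Act (Src A) f (k (Dom C f) y)"
    if f: "f \<in> Arr C" and y: "y \<in> Fib (Src B) (Dom C f)" for f y
  proof -
    have x: "k (Dom C f) y \<in> Fib (Src A) (Dom C f)"
      using k[OF Dom_closed[OF f] y] by simp
    then have "Act (Src A) f (k (Dom C f) y) \<in> Fib (Src A) (Cod C f)"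
      using A f by (auto simp: is_slice_def is_gset_def)
    then show ?thesis
      using act[OF f x] k[OF Dom_closed[OF f] y] h[OF Cod_closed[OF f]] by metis
  qed
  moreover have "Str A p (k p y) = Str B p y" if "p \<in> Obj C" "y \<in> Fib (Src B) p" for p y
    using h k that by metis
  ultimately show ?thesis
    unfolding slice_iso_def slice_map_def gmap_def
    using h k act by (intro exI[of _ h] exI[of _ k]) auto
qed

lemma slice_isoE:
  assumes "slice_iso C A B"
  obtains h k where "iso_pair A B h k"
  using assms by (fastforce simp: slice_iso_def slice_map_def gmap_def iso_pair_def)

text \<open>Classes contain only slices with fibres in \<^typ>\<open>nat\<close>, while \<open>A\<close> and \<open>B\<close> may live over any types. Since
  every slice has such a model, the class of \<open>A\<close> is nonempty and hence determines \<open>A\<close> up to isomorphism.\<close>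

lemma slice_class_eq_iff:
  fixes A :: "('o, 'a, 'x, 't) slice"
  assumes "is_slice C T A"
  shows "slice_class C T A = slice_class C T B \<longleftrightarrow> slice_iso C A B"
proof
  assume "slice_class C T A = slice_class C T B"
  then obtain Z where "Z \<in> slice_class C T A" "Z \<in> slice_class C T B"
    using slice_nat_model[OF assms] by blast
  then have "slice_iso C Z A" "slice_iso C Z B"
    by (simp_all add: slice_class_def)
  then show "slice_iso C A B"
    using slice_iso_trans[OF slice_iso_sym] by blast
next
  assume iso: "slice_iso C A B"
  have "slice_iso C Z A \<longleftrightarrow> slice_iso C Z B" for Z :: "('o, 'a, nat, 't) slice"
    using slice_iso_trans[OF _ iso] slice_iso_trans[OF _ slice_iso_sym[OF iso]] by blast
  then show "slice_class C T A = slice_class C T B"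
    by (simp add: slice_class_def)
qed

lemma is_slice_iff:
  "is_slice C T A \<longleftrightarrow> is_gset C (Src A) \<and>
    (\<forall>p \<in> Obj C. \<forall>x \<in> Fib (Src A) p. Str A p x \<in> Fib T p) \<and>
    (\<forall>f \<in> Arr C. \<forall>x \<in> Fib (Src A) (Dom C f).
      Str A (Cod C f) (Act (Src A) f x) = Act T f (Str A (Dom C f) x))"
  by (auto simp: is_slice_def gmap_def)

lemma is_gset_sum: "\<lbrakk>is_gset C X; is_gset C Y\<rbrakk> \<Longrightarrow> is_gset C (gset_sum X Y)"
  by (auto simp: is_gset_def gset_sum_def Pi_iff)

lemma is_gset_prod: "\<lbrakk>is_gset C X; is_gset C Y\<rbrakk> \<Longrightarrow> is_gset C (gset_prod X Y)"
  by (auto simp: is_gset_def gset_prod_def Pi_iff)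

lemma is_gset_empty: "is_gset C gset_empty"
  by (auto simp: is_gset_def gset_empty_def)

lemma is_gset_unit: "is_gset C gset_unit"
  by (auto simp: is_gset_def gset_unit_def)

lemma is_slice_sum: "\<lbrakk>is_slice C T A; is_slice C T B\<rbrakk> \<Longrightarrow> is_slice C T (slice_sum A B)"
  by (auto simp: is_slice_iff slice_sum_def is_gset_sum) (auto simp: gset_sum_def)

lemma is_slice_empty: "is_slice C T slice_empty"
  by (auto simp: is_slice_iff slice_empty_def is_gset_empty) (auto simp: gset_empty_def)

lemma slice_sum_cong:
  assumes "is_slice C T A" "is_slice C T B" and iso: "slice_iso C A A'" "slice_iso C B B'"
  shows "slice_iso C (slice_sum A B) (slice_sum A' B')"
proof -
  obtain h k h' k' where "iso_pair A A' h k" "iso_pair B B' h' k'"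
    using slice_isoE[OF iso(1)] slice_isoE[OF iso(2)] by metis
  then have "iso_pair (slice_sum A B) (slice_sum A' B')
      (\<lambda>p. map_sum (h p) (h' p)) (\<lambda>p. map_sum (k p) (k' p))"
    by (auto simp: iso_pair_def slice_sum_def gset_sum_def)
  then show ?thesis
    using slice_iso_if_iso_pair is_slice_sum assms(1,2) by blast
qed

lemma slice_sum_assoc:
  assumes "is_slice C T A" "is_slice C T B" "is_slice C T D"
  shows "slice_iso C (slice_sum (slice_sum A B) D) (slice_sum A (slice_sum B D))"
  using assms
  by (intro slice_iso_if_iso_pair[where T = T
        and h = "\<lambda>_. case_sum (case_sum Inl (Inr \<circ> Inl)) (Inr \<circ> Inr)"
        and k = "\<lambda>_. case_sum (Inl \<circ> Inl) (case_sum (Inl \<circ> Inr) Inr)"] is_slice_sum)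
    (auto simp: iso_pair_def slice_sum_def gset_sum_def)

lemma slice_sum_comm:
  assumes "is_slice C T A" "is_slice C T B"
  shows "slice_iso C (slice_sum A B) (slice_sum B A)"
  using assms
  by (intro slice_iso_if_iso_pair[where T = T and h = "\<lambda>_. case_sum Inr Inl" and k = "\<lambda>_. case_sum Inr Inl"]
      is_slice_sum)
    (auto simp: iso_pair_def slice_sum_def gset_sum_def)

lemma slice_sum_empty_left:
  assumes "is_slice C T A"
  shows "slice_iso C (slice_sum slice_empty A) A"
  using assms
  by (intro slice_iso_if_iso_pair[where T = T and h = "\<lambda>_. projr" and k = "\<lambda>_. Inr"]
      is_slice_sum is_slice_empty)
    (auto simp: iso_pair_def slice_sum_def gset_sum_def slice_empty_def gset_empty_def)

end

section \<open>Tensor products of slices over a monoid\<close>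

locale gmonoid_category = category C for C :: "('o, 'a) cat" +
  fixes S :: "('o, 'a, 'm) gmonoid"
  assumes gmonoid: "is_gmonoid C S"
begin

abbreviation cls :: "('o, 'a, 'x, 'm) slice \<Rightarrow> ('o, 'a, nat, 'm) slice set" where
  "cls \<equiv> slice_class C (underlying S)"

abbreviation slc :: "('o, 'a, 'x, 'm) slice \<Rightarrow> bool" where
  "slc \<equiv> is_slice C (underlying S)"

lemma slc_iff:
  "slc A \<longleftrightarrow> is_gset C (Src A) \<and>
    (\<forall>p \<in> Obj C. \<forall>x \<in> Fib (Src A) p. Str A p x \<in> carrier (MObj S p)) \<and>
    (\<forall>f \<in> Arr C. \<forall>x \<in> Fib (Src A) (Dom C f).
      Str A (Cod C f) (Act (Src A) f x) = MAct S f (Str A (Dom C f) x))"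
  by (simp add: is_slice_iff underlying_def)

lemma Str_closed: "\<lbrakk>slc A; p \<in> Obj C; x \<in> Fib (Src A) p\<rbrakk> \<Longrightarrow> Str A p x \<in> carrier (MObj S p)"
  by (simp add: slc_iff)

lemma monoid_MObj: "p \<in> Obj C \<Longrightarrow> Group.monoid (MObj S p)"
  using gmonoid by (simp add: is_gmonoid_def)

lemma MAct_one: "f \<in> Arr C \<Longrightarrow> MAct S f \<one>\<^bsub>MObj S (Dom C f)\<^esub> = \<one>\<^bsub>MObj S (Cod C f)\<^esub>"
  using gmonoid by (simp add: is_gmonoid_def)

lemma MAct_mult:
  "\<lbrakk>f \<in> Arr C; x \<in> carrier (MObj S (Dom C f)); y \<in> carrier (MObj S (Dom C f))\<rbrakk> \<Longrightarrow>
    MAct S f (x \<otimes>\<^bsub>MObj S (Dom C f)\<^esub> y) = MAct S f x \<otimes>\<^bsub>MObj S (Cod C f)\<^esub> MAct S f y"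
  using gmonoid by (simp add: is_gmonoid_def hom_def)

lemma slc_tensor: "\<lbrakk>slc A; slc B\<rbrakk> \<Longrightarrow> slc (slice_tensor S A B)"
  by (auto simp: slc_iff slice_tensor_def is_gset_prod)
    (auto simp: gset_prod_def MAct_mult Dom_closed intro: monoid.m_closed[OF monoid_MObj])

lemma slc_unit: "slc (slice_unit S)"
  by (auto simp: slc_iff slice_unit_def is_gset_unit)
    (auto simp: gset_unit_def MAct_one intro: monoid.one_closed[OF monoid_MObj])

lemma slice_tensor_cong:
  assumes "slc A" "slc B" and iso: "slice_iso C A A'" "slice_iso C B B'"
  shows "slice_iso C (slice_tensor S A B) (slice_tensor S A' B')"
proof -
  obtain h k h' k' where "iso_pair A A' h k" "iso_pair B B' h' k'"
    using slice_isoE[OF iso(1)] slice_isoE[OF iso(2)] by metis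
  then have "iso_pair (slice_tensor S A B) (slice_tensor S A' B')
      (\<lambda>p. map_prod (h p) (h' p)) (\<lambda>p. map_prod (k p) (k' p))"
    by (auto simp: iso_pair_def slice_tensor_def gset_prod_def)
  then show ?thesis
    using slice_iso_if_iso_pair slc_tensor assms(1,2) by blast
qed

lemma slice_tensor_assoc:
  assumes "slc A" "slc B" "slc D"
  shows "slice_iso C (slice_tensor S (slice_tensor S A B) D) (slice_tensor S A (slice_tensor S B D))"
  using assms
  by (intro slice_iso_if_iso_pair[where T = "underlying S" and h = "\<lambda>_ ((x, y), z). (x, (y, z))"
        and k = "\<lambda>_ (x, (y, z)). ((x, y), z)"] slc_tensor)
    (auto simp: iso_pair_def slice_tensor_def gset_prod_def monoid.m_assoc[OF monoid_MObj] Str_closed)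

lemma slice_tensor_unit_left:
  assumes "slc A"
  shows "slice_iso C (slice_tensor S (slice_unit S) A) A"
  using assms
  by (intro slice_iso_if_iso_pair[where T = "underlying S" and h = "\<lambda>_. snd" and k = "\<lambda>_ x. ((), x)"]
      slc_tensor slc_unit)
    (auto simp: iso_pair_def slice_tensor_def gset_prod_def slice_unit_def gset_unit_def
      monoid.l_one[OF monoid_MObj] Str_closed)

lemma slice_tensor_unit_right:
  assumes "slc A"
  shows "slice_iso C (slice_tensor S A (slice_unit S)) A"
  using assms
  by (intro slice_iso_if_iso_pair[where T = "underlying S" and h = "\<lambda>_. fst" and k = "\<lambda>_ x. (x, ())"]
      slc_tensor slc_unit)
    (auto simp: iso_pair_def slice_tensor_def gset_prod_def slice_unit_def gset_unit_def
      monoid.r_one[OF monoid_MObj] Str_closed)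

lemma slice_tensor_sum_left:
  assumes "slc A" "slc B" "slc D"
  shows "slice_iso C (slice_tensor S (slice_sum A B) D)
    (slice_sum (slice_tensor S A D) (slice_tensor S B D))"
  using assms
  by (intro slice_iso_if_iso_pair[where T = "underlying S"
        and h = "\<lambda>_ (s, z). case_sum (\<lambda>x. Inl (x, z)) (\<lambda>y. Inr (y, z)) s"
        and k = "\<lambda>_. case_sum (map_prod Inl id) (map_prod Inr id)"] slc_tensor is_slice_sum)
    (auto simp: iso_pair_def slice_tensor_def gset_prod_def slice_sum_def gset_sum_def)

lemma slice_tensor_sum_right:
  assumes "slc A" "slc B" "slc D"
  shows "slice_iso C (slice_tensor S D (slice_sum A B))
    (slice_sum (slice_tensor S D A) (slice_tensor S D B))"
  using assms
  by (intro slice_iso_if_iso_pair[where T = "underlying S"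
        and h = "\<lambda>_ (z, s). case_sum (\<lambda>x. Inl (z, x)) (\<lambda>y. Inr (z, y)) s"
        and k = "\<lambda>_. case_sum (map_prod id Inl) (map_prod id Inr)"] slc_tensor is_slice_sum)
    (auto simp: iso_pair_def slice_tensor_def gset_prod_def slice_sum_def gset_sum_def)

lemma slice_tensor_empty_left:
  assumes "slc A"
  shows "slice_iso C (slice_tensor S slice_empty A) slice_empty"
  using assms
  by (intro slice_iso_if_iso_pair[where T = "underlying S"
        and h = "\<lambda>_. undefined" and k = "\<lambda>_. undefined"]
      slc_tensor is_slice_empty)
    (auto simp: iso_pair_def slice_tensor_def gset_prod_def slice_empty_def gset_empty_def)

lemma slice_tensor_empty_right:
  assumes "slc A"
  shows "slice_iso C (slice_tensor S A slice_empty) slice_empty"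
  using assms
  by (intro slice_iso_if_iso_pair[where T = "underlying S"
        and h = "\<lambda>_. undefined" and k = "\<lambda>_. undefined"]
      slc_tensor is_slice_empty)
    (auto simp: iso_pair_def slice_tensor_def gset_prod_def slice_empty_def gset_empty_def)

section \<open>The semiring of classes of slices\<close>

lemma cls_eqI: "\<lbrakk>slc A; slice_iso C A B\<rbrakk> \<Longrightarrow> cls A = cls B"
  by (simp add: slice_class_eq_iff)

lemma cls_closed:
  assumes "slc A"
  shows "cls A \<in> carrier (crossed_semiring C S)"
proof -
  obtain Z :: "('o, 'a, nat, 'm) slice" where "slc Z" "slice_iso C Z A"
    using slice_nat_model[OF assms] unfolding slice_class_def by blast
  then show ?thesis
    using cls_eqI[of Z A] by (auto simp: crossed_semiring_def)
qed

lemma crossed_carrierE: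
  assumes "P \<in> carrier (crossed_semiring C S)"
  obtains A :: "('o, 'a, nat, 'm) slice" where "slc A" "P = cls A"
  using assms by (auto simp: crossed_semiring_def)

lemma add_cls:
  assumes A: "slc A" and B: "slc B"
  shows "cls A \<oplus>\<^bsub>crossed_semiring C S\<^esub> cls B = cls (slice_sum A B)"
proof -
  have "cls (slice_sum X Y) = cls (slice_sum A B)" if "X \<in> cls A" "Y \<in> cls B" for X Y
    using that by (intro cls_eqI is_slice_sum slice_sum_cong) (auto simp: slice_class_def)
  then show ?thesis
    using slice_nat_model[OF A] slice_nat_model[OF B] by (auto simp: crossed_semiring_def)
qed

lemma mult_cls:
  assumes A: "slc A" and B: "slc B"
  shows "cls A \<otimes>\<^bsub>crossed_semiring C S\<^esub> cls B = cls (slice_tensor S A B)"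
proof -
  have "cls (slice_tensor S X Y) = cls (slice_tensor S A B)" if "X \<in> cls A" "Y \<in> cls B" for X Y
    using that by (intro cls_eqI slc_tensor slice_tensor_cong) (auto simp: slice_class_def)
  then show ?thesis
    using slice_nat_model[OF A] slice_nat_model[OF B] by (auto simp: crossed_semiring_def)
qed

lemma zero_crossed: "\<zero>\<^bsub>crossed_semiring C S\<^esub> = cls (slice_empty :: ('o, 'a, nat, 'm) slice)"
  and one_crossed: "\<one>\<^bsub>crossed_semiring C S\<^esub> = cls (slice_unit S)"
  by (simp_all add: crossed_semiring_def)

text \<open>Each axiom is the shadow of one of the structural isomorphisms above. Multiplication need
  not commute, as the fibres of \<open>S\<close> are arbitrary monoids; both distributive and both absorption
  laws are therefore separate isomorphisms.\<close>

theorem semiring_crossed: "semiring (crossed_semiring C S)"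
proof -
  note simps = add_cls mult_cls zero_crossed one_crossed cls_closed slc_tensor slc_unit
    is_slice_sum is_slice_empty slice_class_eq_iff
  note sum_isos = slice_sum_assoc slice_sum_comm slice_sum_empty_left
  have "abelian_monoid (crossed_semiring C S)"
    by (rule abelian_monoidI; (elim crossed_carrierE)?)
      (simp_all add: simps sum_isos[where T = "underlying S"])
  moreover have "monoid (crossed_semiring C S)"
    by (rule monoidI; (elim crossed_carrierE)?)
      (simp_all add: simps slice_tensor_assoc slice_tensor_unit_left slice_tensor_unit_right)
  moreover have "semiring_axioms (crossed_semiring C S)"
    by (rule semiring_axioms.intro; elim crossed_carrierE)
      (simp_all add: simps slice_tensor_sum_left slice_tensor_sum_right
        slice_tensor_empty_left slice_tensor_empty_right)
  ultimately show ?thesis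
    by (rule semiring.intro)
qed

section \<open>G-sets as slices with constant structure map\<close>

definition const_one :: "('o, 'a, 'x) gset \<Rightarrow> ('o, 'a, 'x, 'm) slice" where
  "const_one X = \<lparr>Src = X, Str = (\<lambda>p _. \<one>\<^bsub>MObj S p\<^esub>)\<rparr>"

abbreviation gcls :: "('o, 'a, 'x) gset \<Rightarrow> ('o, 'a, nat) gset set" where
  "gcls \<equiv> gset_class C"

lemma Src_const_one [simp]: "Src (const_one X) = X"
  by (simp add: const_one_def)

text \<open>The constant family of units is equivariant because a \<open>\<G>\<close>-monoid acts by unital homomorphisms.\<close>

lemma slc_const_one_iff: "slc (const_one X) \<longleftrightarrow> is_gset C X"
  by (auto simp: slc_iff const_one_def MAct_one intro: monoid.one_closed[OF monoid_MObj])

lemma giso_if_slice_iso: "slice_iso C A B \<Longrightarrow> giso C (Src A) (Src B)"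
  unfolding slice_iso_def giso_def slice_map_def by blast

text \<open>The structure map is constant, so compatibility with it is no condition on a map. Consequently
  the theory of isomorphisms of \<open>\<G>\<close>-sets is a special case of that for slices.\<close>

lemma giso_iff_const_one: "giso C X Y \<longleftrightarrow> slice_iso C (const_one X) (const_one Y)"
  by (simp add: slice_iso_def giso_def slice_map_def const_one_def)

lemma giso_sym: "giso C X Y \<Longrightarrow> giso C Y X"
  unfolding giso_iff_const_one by (rule slice_iso_sym)

lemma giso_trans: "\<lbrakk>giso C X Y; giso C Y Z\<rbrakk> \<Longrightarrow> giso C X Z"
  unfolding giso_iff_const_one by (rule slice_iso_trans)

lemma gcls_eq_iff:
  assumes "is_gset C X"
  shows "gcls X = gcls Y \<longleftrightarrow> giso C X Y"
proof
  assume "gcls X = gcls Y"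
  then obtain Z where "Z \<in> gcls X" "Z \<in> gcls Y"
    using gset_nat_model[OF assms] by blast
  then have "giso C Z X" "giso C Z Y"
    by (simp_all add: gset_class_def)
  then show "giso C X Y"
    using giso_trans[OF giso_sym] by blast
next
  assume iso: "giso C X Y"
  have "giso C Z X \<longleftrightarrow> giso C Z Y" for Z :: "('o, 'a, nat) gset"
    using giso_trans[OF _ iso] giso_trans[OF _ giso_sym[OF iso]] by blast
  then show "gcls X = gcls Y"
    by (simp add: gset_class_def)
qed

lemma gcls_eqI: "\<lbrakk>is_gset C X; giso C X Y\<rbrakk> \<Longrightarrow> gcls X = gcls Y"
  by (simp add: gcls_eq_iff)

lemma slice_iso_if_same_source:
  assumes "slc A" "Src B = Src A"
    "\<And>p x. \<lbrakk>p \<in> Obj C; x \<in> Fib (Src A) p\<rbrakk> \<Longrightarrow> Str B p x = Str A p x"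
  shows "slice_iso C A B"
  using assms
  by (intro slice_iso_if_iso_pair[where T = "underlying S" and h = "\<lambda>_ x. x" and k = "\<lambda>_ x. x"])
    (auto simp: iso_pair_def)

lemma const_one_sum:
  assumes "is_gset C X" "is_gset C Y"
  shows "slice_iso C (const_one (gset_sum X Y)) (slice_sum (const_one X) (const_one Y))"
  using assms
  by (intro slice_iso_if_same_source)
    (auto simp: slc_const_one_iff is_gset_sum, auto simp: slice_sum_def const_one_def gset_sum_def)

text \<open>Here the two structure maps agree because \<open>1 \<cdot> 1 = 1\<close> in each monoid; this is what makes the embedding
  multiplicative.\<close>

lemma const_one_prod:
  assumes "is_gset C X" "is_gset C Y"
  shows "slice_iso C (const_one (gset_prod X Y)) (slice_tensor S (const_one X) (const_one Y))"
  using assms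
  by (intro slice_iso_if_same_source)
    (auto simp: slc_const_one_iff is_gset_prod, auto simp: slice_tensor_def const_one_def gset_prod_def
      monoid.l_one[OF monoid_MObj] monoid.one_closed[OF monoid_MObj])

lemma const_one_unit: "slice_iso C (const_one gset_unit) (slice_unit S)"
  by (intro slice_iso_if_same_source)
    (auto simp: slc_const_one_iff is_gset_unit, auto simp: slice_unit_def const_one_def)

lemma const_one_empty:
  "slice_iso C (const_one (gset_empty :: ('o, 'a, 'x) gset))
    (slice_empty :: ('o, 'a, 'x, 'm) slice)"
  by (intro slice_iso_if_same_source)
    (auto simp: slc_const_one_iff is_gset_empty, auto simp: slice_empty_def const_one_def gset_empty_def)

lemma giso_sum_cong:
  assumes "is_gset C X" "is_gset C Y" "giso C X X'" "giso C Y Y'"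
  shows "giso C (gset_sum X Y) (gset_sum X' Y')"
proof -
  have "slice_iso C (slice_sum (const_one X) (const_one Y))
      (slice_sum (const_one X') (const_one Y'))"
    using assms
    by (intro slice_sum_cong[where T = "underlying S"]) (auto simp: slc_const_one_iff giso_iff_const_one)
  from giso_if_slice_iso[OF this] show ?thesis
    by (simp add: slice_sum_def)
qed

lemma giso_prod_cong:
  assumes "is_gset C X" "is_gset C Y" "giso C X X'" "giso C Y Y'"
  shows "giso C (gset_prod X Y) (gset_prod X' Y')"
proof -
  have "slice_iso C (slice_tensor S (const_one X) (const_one Y))
      (slice_tensor S (const_one X') (const_one Y'))"
    using assms by (intro slice_tensor_cong) (auto simp: slc_const_one_iff giso_iff_const_one)
  from giso_if_slice_iso[OF this] show ?thesis
    by (simp add: slice_tensor_def)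
qed

lemma gcls_closed:
  assumes "is_gset C X"
  shows "gcls X \<in> carrier (gset_semiring C)"
proof -
  obtain Z :: "('o, 'a, nat) gset" where "is_gset C Z" "giso C Z X"
    using gset_nat_model[OF assms] unfolding gset_class_def by blast
  then show ?thesis
    using gcls_eqI[of Z X] by (auto simp: gset_semiring_def)
qed

lemma gset_carrierE:
  assumes "P \<in> carrier (gset_semiring C)"
  obtains X :: "('o, 'a, nat) gset" where "is_gset C X" "P = gcls X"
  using assms by (auto simp: gset_semiring_def)

lemma add_gcls:
  assumes X: "is_gset C X" and Y: "is_gset C Y"
  shows "gcls X \<oplus>\<^bsub>gset_semiring C\<^esub> gcls Y = gcls (gset_sum X Y)"
proof -
  have "gcls (gset_sum X' Y') = gcls (gset_sum X Y)" if "X' \<in> gcls X" "Y' \<in> gcls Y" for X' Y'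
    using that by (intro gcls_eqI is_gset_sum giso_sum_cong) (auto simp: gset_class_def)
  then show ?thesis
    using gset_nat_model[OF X] gset_nat_model[OF Y] by (auto simp: gset_semiring_def)
qed

lemma mult_gcls:
  assumes X: "is_gset C X" and Y: "is_gset C Y"
  shows "gcls X \<otimes>\<^bsub>gset_semiring C\<^esub> gcls Y = gcls (gset_prod X Y)"
proof -
  have "gcls (gset_prod X' Y') = gcls (gset_prod X Y)" if "X' \<in> gcls X" "Y' \<in> gcls Y" for X' Y'
    using that by (intro gcls_eqI is_gset_prod giso_prod_cong) (auto simp: gset_class_def)
  then show ?thesis
    using gset_nat_model[OF X] gset_nat_model[OF Y] by (auto simp: gset_semiring_def)
qed

lemma zero_gset: "\<zero>\<^bsub>gset_semiring C\<^esub> = gcls (gset_empty :: ('o, 'a, nat) gset)"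
  and one_gset: "\<one>\<^bsub>gset_semiring C\<^esub> = gcls gset_unit"
  by (simp_all add: gset_semiring_def)

definition embed_class :: "('o, 'a, nat) gset set \<Rightarrow> ('o, 'a, nat, 'm) slice set" where
  "embed_class P = (\<Union>X \<in> P. cls (const_one X))"

definition forget_class :: "('o, 'a, nat, 'm) slice set \<Rightarrow> ('o, 'a, nat) gset set" where
  "forget_class Q = (\<Union>A \<in> Q. gcls (Src A))"

lemma embed_class_gcls:
  assumes "is_gset C X"
  shows "embed_class (gcls X) = cls (const_one X)"
proof -
  have "cls (const_one X') = cls (const_one X)" if "X' \<in> gcls X" for X'
    using that by (intro cls_eqI) (auto simp: gset_class_def slc_const_one_iff giso_iff_const_one)
  then show ?thesis
    using gset_nat_model[OF assms] by (auto simp: embed_class_def)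
qed

lemma forget_class_cls:
  assumes "slc A"
  shows "forget_class (cls A) = gcls (Src A)"
proof -
  have "gcls (Src A') = gcls (Src A)" if "A' \<in> cls A" for A'
    using that by (intro gcls_eqI) (auto simp: slice_class_def is_slice_def giso_if_slice_iso)
  then show ?thesis
    using slice_nat_model[OF assms] by (auto simp: forget_class_def)
qed

lemma forget_class_embed_class:
  "P \<in> carrier (gset_semiring C) \<Longrightarrow> forget_class (embed_class P) = P"
  by (auto elim!: gset_carrierE simp: embed_class_gcls forget_class_cls slc_const_one_iff)

lemma forget_class_closed:
  "Q \<in> carrier (crossed_semiring C S) \<Longrightarrow> forget_class Q \<in> carrier (gset_semiring C)"
  by (auto elim!: crossed_carrierE simp: forget_class_cls is_slice_def intro!: gcls_closed)

lemma forget_class_add: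
  assumes "P \<in> carrier (crossed_semiring C S)" "Q \<in> carrier (crossed_semiring C S)"
  shows "forget_class (P \<oplus>\<^bsub>crossed_semiring C S\<^esub> Q) = forget_class P \<oplus>\<^bsub>gset_semiring C\<^esub> forget_class Q"
proof -
  obtain A B :: "('o, 'a, nat, 'm) slice" where AB: "slc A" "slc B" "P = cls A" "Q = cls B"
    using assms by (metis crossed_carrierE)
  then have "is_gset C (Src A)" "is_gset C (Src B)"
    by (auto simp: is_slice_def)
  then show ?thesis
    using AB by (simp add: add_cls forget_class_cls is_slice_sum add_gcls) (simp add: slice_sum_def)
qed

lemma embed_class_zero: "embed_class \<zero>\<^bsub>gset_semiring C\<^esub> = \<zero>\<^bsub>crossed_semiring C S\<^esub>"
  by (simp add: zero_gset zero_crossed embed_class_gcls is_gset_empty)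
    (intro cls_eqI const_one_empty, simp add: slc_const_one_iff is_gset_empty)

lemma embed_class_ring_hom: "embed_class \<in> ring_hom (gset_semiring C) (crossed_semiring C S)"
  by (rule ring_hom_memI; (elim gset_carrierE)?)
    (simp_all add: embed_class_gcls slc_const_one_iff add_gcls mult_gcls add_cls mult_cls
      one_gset one_crossed is_gset_sum is_gset_prod is_gset_unit cls_closed slice_class_eq_iff
      const_one_sum const_one_prod const_one_unit)

text \<open>Since \<open>\<G>\<close>-sets embed into slices over \<open>S\<close> compatibly with all operations, the structural
  isomorphisms need not be constructed again for them.\<close>

theorem semiring_gset: "semiring (gset_semiring C)"
proof (rule semiring_pullback[OF semiring_crossed embed_class_ring_hom _ embed_class_zero])
  show "inj_on embed_class (carrier (gset_semiring C))"
    using forget_class_embed_class by (rule inj_on_inverseI)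
qed (auto elim!: gset_carrierE simp: add_gcls mult_gcls zero_gset one_gset
    intro!: gcls_closed is_gset_sum is_gset_prod is_gset_empty is_gset_unit)

theorem burnside_embeds:
  "ring_hom_ring (burnside_ring C) (crossed_burnside_ring C S)
     (completion_map (gset_semiring C) (crossed_semiring C S) embed_class)"
  "inj_on (completion_map (gset_semiring C) (crossed_semiring C S) embed_class)
     (carrier (burnside_ring C))"
  unfolding burnside_ring_def crossed_burnside_ring_def
  using completion_map_ring_hom[OF semiring_gset semiring_crossed embed_class_ring_hom
      embed_class_zero]
    completion_map_inj[OF semiring_gset semiring_crossed embed_class_ring_hom _ forget_class_add
      forget_class_embed_class]
    forget_class_closed
  by auto

end

theorem theorem3p6:
  fixes G :: "('o, 'a) cat" and S :: "('o, 'a, 'm) gmonoid"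
  assumes "finite_groupoid G"
    and "Obj G \<noteq> {}"
    and "is_gmonoid G S"
  shows "\<exists>h. ring_hom_ring (burnside_ring G) (crossed_burnside_ring G S) h \<and>
             inj_on h (carrier (burnside_ring G))"
proof -
  interpret gmonoid_category G S
    using assms(1,3)
    by (auto intro!: gmonoid_category.intro gmonoid_category_axioms.intro
        simp: finite_groupoid_def groupoid_def)
  show ?thesis
    using burnside_embeds by blast
qed

end
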